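(* Let $R=\mathbb{F}_2\langle a,x : a=a^2x\rangle$. (1) The set of left zero-divisors of $R$ is $Ra$. (2) The set of right zero-divisors of $R$ is $\bigcup_{n=1}^{\infty} r_R(a^n)$.
   Context: $R=\mathbb{F}_2\langle a,x: a=a^2x\rangle$ denotes the quotient of the free unital associative (noncommutative) $\mathbb{F}_2$-algebra on two generators $a,x$ by the two-sided ideal generated by $a-a^2x$. For an element $s$ of a ring $S$, $r_S(s)=\{t\in S: st=0\}$ and $l_S(s)=\{t\in S: ts=0\}$. An element $s\in S$ is a left zero-divisor if $r_S(s)\neq 0$, and a right zero-divisor if $l_S(s)\ne 0$ (so $0$ is counted as both in a nonzero ring with identity). *)

theory Defs
  imports
    "HOL-Library.Poly_Mapping"
    "HOL-Library.Z2"
    "HOL-Algebra.QuotRing"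
    "HOL-Algebra.Algebraic_Closure_Type"
begin

text \<open>
  The free monoid on \<open>'g\<close>, written additively so that \<open>'g word \<Rightarrow>\<^sub>0 'k\<close>, with the
  convolution product of \<open>Poly_Mapping\<close>, is the monoid algebra of words, i.e. the free
  unital associative algebra on \<open>'g\<close>. The addition of words is not commutative. The type \<open>bit\<close> is the
  field with two elements, and \<open>Idl\<close> below is the generated two-sided ideal.
\<close>

datatype 'g word = Word (letters: "'g list")

instantiation word :: (type) monoid_add
begin

definition zero_word :: "'a word" where
  "0 = Word []"

definition plus_word :: "'a word \<Rightarrow> 'a word \<Rightarrow> 'a word" where
  "u + v = Word (letters u @ letters v)"

instance
  by standard (simp_all add: zero_word_def plus_word_def)

end

datatype gen = Gen_a | Gen_x

type_synonym free_alg = "gen word \<Rightarrow>\<^sub>0 bit"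

definition free_gen :: "gen \<Rightarrow> free_alg" where
  "free_gen g = Poly_Mapping.single (Word [g]) 1"

definition free_ring :: "free_alg ring" where
  "free_ring = ring_of_type_algebra"

definition rel_ideal :: "free_alg set" where
  "rel_ideal = Idl\<^bsub>free_ring\<^esub> {free_gen Gen_a - free_gen Gen_a ^ 2 * free_gen Gen_x}"

definition R_alg :: "free_alg set ring" where
  "R_alg = free_ring Quot rel_ideal"

definition elem_a :: "free_alg set" where
  "elem_a = rel_ideal +>\<^bsub>free_ring\<^esub> free_gen Gen_a"

definition elem_x :: "free_alg set" where
  "elem_x = rel_ideal +>\<^bsub>free_ring\<^esub> free_gen Gen_x"

definition right_ann :: "('a, 'm) ring_scheme \<Rightarrow> 'a \<Rightarrow> 'a set" where
  "right_ann S s = {t \<in> carrier S. s \<otimes>\<^bsub>S\<^esub> t = \<zero>\<^bsub>S\<^esub>}"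

definition left_ann :: "('a, 'm) ring_scheme \<Rightarrow> 'a \<Rightarrow> 'a set" where
  "left_ann S s = {t \<in> carrier S. t \<otimes>\<^bsub>S\<^esub> s = \<zero>\<^bsub>S\<^esub>}"

definition left_zero_divisors :: "('a, 'm) ring_scheme \<Rightarrow> 'a set" where
  "left_zero_divisors S = {s \<in> carrier S. right_ann S s \<noteq> {\<zero>\<^bsub>S\<^esub>}}"

definition right_zero_divisors :: "('a, 'm) ring_scheme \<Rightarrow> 'a set" where
  "right_zero_divisors S = {s \<in> carrier S. left_ann S s \<noteq> {\<zero>\<^bsub>S\<^esub>}}"

lemma ring_free_ring: "ring free_ring"
proof (rule ringI)
  have "\<exists>q. q + p = 0" for p :: free_alg
    by (rule exI[of _ "- p"]) simp
  then show "abelian_group free_ring"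
    by (intro abelian_groupI) (simp_all add: free_ring_def ring_of_type_algebra_def ac_simps)
  show "Group.monoid free_ring"
    by (rule monoidI) (simp_all add: free_ring_def ring_of_type_algebra_def mult.assoc)
qed (simp_all add: free_ring_def ring_of_type_algebra_def algebra_simps)

lemma ideal_rel_ideal: "ideal rel_ideal free_ring"
  unfolding rel_ideal_def
  by (rule ring.genideal_ideal[OF ring_free_ring])
     (simp add: free_ring_def ring_of_type_algebra_def)

lemma ring_R_alg: "ring R_alg"
  unfolding R_alg_def by (rule ideal.quotient_is_ring[OF ideal_rel_ideal])

lemma elem_a_closed: "elem_a \<in> carrier R_alg" and elem_x_closed: "elem_x \<in> carrier R_alg"
  by (auto simp: elem_a_def elem_x_def R_alg_def FactRing_def A_RCOSETS_def'
      free_ring_def ring_of_type_algebra_def)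

lemma relation_R_alg: "elem_a = elem_a [^]\<^bsub>R_alg\<^esub> (2::nat) \<otimes>\<^bsub>R_alg\<^esub> elem_x"
proof -
  interpret F: ring free_ring by (rule ring_free_ring)
  interpret I: ideal rel_ideal free_ring by (rule ideal_rel_ideal)
  interpret Q: ring R_alg by (rule ring_R_alg)
  let ?a = "free_gen Gen_a" and ?x = "free_gen Gen_x"
  have C [simp]: "p \<in> carrier free_ring" for p
    by (simp add: free_ring_def ring_of_type_algebra_def)
  have M [simp]: "p \<otimes>\<^bsub>free_ring\<^esub> q = p * q" for p q
    by (simp add: free_ring_def ring_of_type_algebra_def)
  have "elem_a [^]\<^bsub>R_alg\<^esub> (2::nat) = elem_a \<otimes>\<^bsub>R_alg\<^esub> elem_a"
    using elem_a_closed by (simp add: numeral_2_eq_2)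
  then have "elem_a [^]\<^bsub>R_alg\<^esub> (2::nat) \<otimes>\<^bsub>R_alg\<^esub> elem_x = rel_ideal +>\<^bsub>free_ring\<^esub> (?a * ?a * ?x)"
    by (simp add: elem_a_def elem_x_def R_alg_def FactRing_def I.rcoset_mult_add)
  moreover have "?a - ?a ^ 2 * ?x \<in> rel_ideal"
    unfolding rel_ideal_def using F.genideal_self' C by blast
  then have "?a \<in> rel_ideal +>\<^bsub>free_ring\<^esub> (?a * ?a * ?x)"
    by (auto simp: a_r_coset_def r_coset_def free_ring_def ring_of_type_algebra_def
        power2_eq_square intro!: bexI[of _ "?a - ?a ^ 2 * ?x"])
  then have "elem_a = rel_ideal +>\<^bsub>free_ring\<^esub> (?a * ?a * ?x)"
    unfolding elem_a_def using I.a_repr_independence' C by metis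
  ultimately show ?thesis by simp
qed

end

theory Submission
  imports Defs
begin

text \<open>
  Read as the rewriting rule \<open>aax \<rightarrow> a\<close>, the defining relation has no overlaps, so the words
  without factor \<open>aax\<close> form a monoid \<open>M\<close> under ``concatenate and reduce'', and \<open>R\<close> is the algebra
  of \<open>M\<close> over the field with two elements. Put \<open>b = ax\<close>. An element of \<open>M\<close> is uniquely a word in
  \<open>x\<close> and \<open>b\<close> followed by a power of \<open>a\<close>; left multiplication by \<open>x\<close> or \<open>b\<close> just prepends a letter,
  while left multiplication by \<open>a\<close> deletes all leading \<open>b\<close>s and then turns a leading \<open>x\<close> into \<open>b\<close> or,
  if only \<open>a\<^sup>k\<close> is left, produces \<open>a\<^sup>k\<^sup>+\<^sup>1\<close>. In particular \<open>a b = a\<close>, so \<open>a (b + 1) = 0\<close>.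

  Both halves of the theorem follow from one cancellation principle, \<open>dead_if_product_eq_0\<close>:
  if \<open>S w = 0\<close> and the word \<open>p a\<^sup>k\<close> (with \<open>p\<close> a word in \<open>x\<close> and \<open>b\<close>) occurs in \<open>S\<close>,
  then already \<open>a\<^sup>k w = 0\<close>. Indeed, if \<open>w \<noteq> 0\<close> then no word of \<open>S\<close> has \<open>k = 0\<close>, that is,
  \<open>S \<in> R a\<close>; and if \<open>S \<noteq> 0\<close> then any word of \<open>S\<close> gives a power of \<open>a\<close> killing \<open>w\<close>. The converses
  are \<open>r a (b + 1) = 0\<close> and \<open>a\<^sup>n \<noteq> 0\<close>.

  The principle says that the nonzero elements among \<open>w, a w, a\<^sup>2 w, \<dots>\<close> are left linearly independent
  over the free algebra on \<open>x\<close> and \<open>b\<close>. Over the polynomials in \<open>b\<close> alone this comes from an integer valued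
  \<open>level\<close> on \<open>M\<close> that left multiplication by \<open>b\<close> preserves and left multiplication by \<open>a\<close> strictly
  lowers: the nonzero \<open>a\<^sup>k w\<close> have strictly decreasing top levels. The general case is reduced to this one
  by multiplying \<open>S\<close> by \<open>a\<close> on the left, which makes its words lighter for a suitable \<open>weight\<close>. What is lost
  in passing from \<open>S\<close> to \<open>a S\<close> is an element of \<open>(b + 1) R\<close>, and \<open>b + 1\<close> can be cancelled without changing
  top levels. To make this induction work, the hypothesis \<open>S w = 0\<close> is relaxed to an upper bound on the
  level of \<open>S w\<close>, at the price of one exceptional kind of word in the conclusion
  (\<open>nearly_dead_if_below_all\<close>).
\<close>

section \<open>Monoid algebras over the field with two elements\<close>

abbreviation keys :: "('m \<Rightarrow>\<^sub>0 'k::zero) \<Rightarrow> 'm set" where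
  "keys \<equiv> Poly_Mapping.keys"

abbreviation mon :: "'m \<Rightarrow> 'm \<Rightarrow>\<^sub>0 bit" where
  "mon m \<equiv> Poly_Mapping.single m 1"

lemma add_self_bit_poly [simp]: "f + f = (0 :: 'm \<Rightarrow>\<^sub>0 bit)"
  by (rule poly_mapping_eqI) (simp add: lookup_add)

lemma uminus_bit_poly [simp]: "- f = (f :: 'm \<Rightarrow>\<^sub>0 bit)"
  using add_self_bit_poly[of f] by (metis add_eq_0_iff)

lemma diff_bit_poly [simp]: "f - g = f + (g :: 'm \<Rightarrow>\<^sub>0 bit)"
  by (metis uminus_bit_poly diff_conv_add_uminus)

lemma mon_ne_0 [simp]: "mon m \<noteq> 0"
  by (metis keys_single keys_zero insert_not_empty zero_neq_one)

lemma sum_mon: "(\<Sum>u\<in>keys f. mon u) = (f :: 'm \<Rightarrow>\<^sub>0 bit)"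
proof -
  have "Poly_Mapping.lookup (\<Sum>u\<in>keys f. mon u) v = Poly_Mapping.lookup f v" for v
    by (simp add: lookup_sum lookup_single when_def sum.delta' in_keys_iff)
  then show ?thesis by (rule poly_mapping_eqI)
qed

lemma keys_sum_mon:
  assumes "finite K"
  shows "keys (\<Sum>u\<in>K. mon u) = K"
  using assms
proof (induction K rule: finite_induct)
  case (insert u K)
  have "keys (mon u + (\<Sum>v\<in>K. mon v)) = keys (mon u) \<union> keys (\<Sum>v\<in>K. mon v)"
    by (intro equalityI Poly_Mapping.keys_add subsetI)
       (use insert in \<open>auto simp: in_keys_iff lookup_add lookup_sum lookup_single when_def\<close>)
  then show ?case using insert by simp
qed simp

text \<open>
  All coefficients being \<open>0\<close> or \<open>1\<close>, an element is the sum of the words in its support, which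
  makes induction along the support a matter of sums of words.
\<close>

lemma bit_poly_induct [case_names zero mon add]:
  assumes "P 0" and "\<And>u. u \<in> keys f \<Longrightarrow> P (mon u)" and "\<And>g h. P g \<Longrightarrow> P h \<Longrightarrow> P (g + h)"
  shows "P (f :: 'm \<Rightarrow>\<^sub>0 bit)"
proof -
  have "P (\<Sum>u\<in>K. mon u)" if "finite K" "K \<subseteq> keys f" for K
    using that by (induction K rule: finite_induct) (auto intro: assms)
  from this[of "keys f"] show ?thesis by (simp add: sum_mon)
qed

lemma split_keys:
  fixes f :: "'m \<Rightarrow>\<^sub>0 bit"
  obtains g h where "f = g + h" "keys g = {u \<in> keys f. P u}" "keys h = {u \<in> keys f. \<not> P u}"
proof
  let ?G = "{u \<in> keys f. P u}" and ?H = "{u \<in> keys f. \<not> P u}"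
  have "sum mon (?G \<union> ?H) = sum mon ?G + sum mon ?H"
    by (rule sum.union_disjoint) auto
  moreover have "?G \<union> ?H = keys f" by auto
  ultimately show "f = sum mon ?G + sum mon ?H" by (simp add: sum_mon)
qed (simp_all add: keys_sum_mon)

lemma factor_mon_right:
  fixes f :: "'m::monoid_add \<Rightarrow>\<^sub>0 bit"
  assumes "\<And>u. u \<in> keys f \<Longrightarrow> g u + m = u"
  obtains q where "f = q * mon m" "keys q \<subseteq> g ` keys f"
proof
  have "(\<Sum>u\<in>keys f. mon (g u)) * mon m = (\<Sum>u\<in>keys f. mon u)"
    unfolding sum_distrib_right by (rule sum.cong) (simp_all add: mult_single assms)
  then show "f = (\<Sum>u\<in>keys f. mon (g u)) * mon m" by (simp add: sum_mon)
  have "keys (\<Sum>u\<in>K. mon (g u) :: _ \<Rightarrow>\<^sub>0 bit) \<subseteq> g ` K" if "finite K" for K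
    using that
  proof (induction K rule: finite_induct)
    case (insert u K)
    then show ?case using Poly_Mapping.keys_add[of "mon (g u) :: _ \<Rightarrow>\<^sub>0 bit" "\<Sum>u\<in>K. mon (g u)"] by auto
  qed simp
  then show "keys (\<Sum>u\<in>keys f. mon (g u) :: _ \<Rightarrow>\<^sub>0 bit) \<subseteq> g ` keys f" by simp
qed

text \<open>
  A product of words that arises in only one way from the two supports cannot cancel. This is
  applied below to words that are extreme in some order, and to left multiplication by \<open>a\<close> where it merges
  no words.
\<close>

lemma unique_product_in_keys:
  fixes f g :: "'m::monoid_add \<Rightarrow>\<^sub>0 bit"
  assumes "m \<in> keys f" "u \<in> keys g"
    and uniq: "\<And>m' u'. m' \<in> keys f \<Longrightarrow> u' \<in> keys g \<Longrightarrow> m' + u' = m + u \<Longrightarrow> m' = m \<and> u' = u"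
  shows "m + u \<in> keys (f * g)"
proof -
  obtain f1 f2 where f: "f = f1 + f2" "keys f1 = {v \<in> keys f. v = m}" "keys f2 = {v \<in> keys f. v \<noteq> m}"
    by (rule split_keys)
  obtain g1 g2 where g: "g = g1 + g2" "keys g1 = {v \<in> keys g. v = u}" "keys g2 = {v \<in> keys g. v \<noteq> u}"
    by (rule split_keys)
  have "keys f1 = {m}" "keys g1 = {u}" using f g assms by auto
  then have 1: "f1 = mon m" "g1 = mon u" using sum_mon[of f1] sum_mon[of g1] by auto
  have "f * g = f1 * (g1 + g2) + f2 * g"
    unfolding g(1)[symmetric] distrib_right[symmetric] f(1)[symmetric] ..
  also have "\<dots> = mon (m + u) + (f1 * g2 + f2 * g)"
    unfolding 1 by (simp only: distrib_left mult_single mult_1 add.assoc)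
  finally have "f * g = mon (m + u) + (f1 * g2 + f2 * g)" .
  moreover have "m + u \<notin> keys (f1 * g2)"
  proof
    assume "m + u \<in> keys (f1 * g2)"
    then obtain m' u' where "m' \<in> keys f1" "u' \<in> keys g2" "m + u = m' + u'"
      using keys_mult[of f1 g2] by blast
    then show False using uniq[of m' u'] f(2) g(3) by auto
  qed
  moreover have "m + u \<notin> keys (f2 * g)"
  proof
    assume "m + u \<in> keys (f2 * g)"
    then obtain m' u' where "m' \<in> keys f2" "u' \<in> keys g" "m + u = m' + u'"
      using keys_mult[of f2 g] by blast
    then show False using uniq[of m' u'] f(3) by auto
  qed
  ultimately show ?thesis
    by (simp add: in_keys_iff lookup_add)
qed

section \<open>The monoid of normal words\<close>

text \<open>
  Normal words are encoded so that their three shapes are visible to recursion: \<open>NA k\<close> is \<open>a\<^sup>k\<close>,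
  \<open>NX u\<close> is \<open>xu\<close>, and \<open>NAX u\<close> is \<open>axu\<close>. Every such term denotes a word without factor \<open>aax\<close>,
  since every \<open>a\<close> before the final power of \<open>a\<close> is followed at once by \<open>x\<close>.
\<close>

datatype normal_word = NA nat | NX normal_word | NAX normal_word

text \<open>
  The reduced form of \<open>au\<close>. The last equation is the rewriting step \<open>a(axu) \<rightarrow> au\<close>.
\<close>

fun left_a :: "normal_word \<Rightarrow> normal_word" where
  "left_a (NA k) = NA (Suc k)"
| "left_a (NX u) = NAX u"
| "left_a (NAX u) = left_a u"

instantiation normal_word :: monoid_add
begin

definition zero_normal_word :: normal_word where
  "0 = NA 0"

fun plus_normal_word :: "normal_word \<Rightarrow> normal_word \<Rightarrow> normal_word" where
  "NA k + v = (left_a ^^ k) v"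
| "NX u + v = NX (u + v)"
| "NAX u + v = NAX (u + v)"

lemma left_a_add: "left_a u + v = left_a (u + v)"
  by (induction u rule: left_a.induct) simp_all

instance
proof
  fix u v w :: normal_word
  have "(left_a ^^ k) v + w = (left_a ^^ k) (v + w)" for k
    by (induction k) (simp_all add: left_a_add)
  then show "u + v + w = u + (v + w)"
    by (induction u) simp_all
  show "0 + u = u" by (simp add: zero_normal_word_def)
  have "(left_a ^^ k) (NA 0) = NA k" for k by (induction k) simp_all
  then show "u + 0 = u" by (induction u) (simp_all add: zero_normal_word_def)
qed

end

abbreviation a :: "normal_word \<Rightarrow>\<^sub>0 bit" where "a \<equiv> mon (NA (Suc 0))"
abbreviation b :: "normal_word \<Rightarrow>\<^sub>0 bit" where "b \<equiv> mon (NAX 0)"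

lemma NA_pow_add [simp]: "(left_a ^^ j) (NA k) = NA (j + k)"
  by (induction j) simp_all

lemma NAX_pow_0_add [simp]: "(NAX ^^ i) 0 + v = (NAX ^^ i) v"
  by (induction i) simp_all

lemma NAX_pow_inject [simp]: "(NAX ^^ i) u = (NAX ^^ i) v \<longleftrightarrow> u = v"
  by (induction i) simp_all

lemma a_power: "a ^ k = mon (NA k)"
  by (induction k) (simp_all add: mult_single zero_normal_word_def[symmetric])

lemma a_power_ne_0: "a ^ k \<noteq> 0"
  by (simp add: a_power)

lemma b_mult_mon: "b * mon u = mon (NAX u)"
  by (simp add: mult_single)

text \<open>
  The source of all left zero-divisors.
\<close>

lemma a_mult_b_plus_1: "a * (b + 1) = 0"
proof -
  have "a * b = a" by (simp add: mult_single zero_normal_word_def)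
  then show ?thesis by (simp add: distrib_left)
qed

text \<open>
  \<open>stem\<close> and \<open>exponent\<close> split a normal word as \<open>p a\<^sup>k\<close> with \<open>p\<close> a word in \<open>x\<close> and \<open>b\<close>.
\<close>

fun exponent :: "normal_word \<Rightarrow> nat" where
  "exponent (NA k) = k"
| "exponent (NX u) = exponent u"
| "exponent (NAX u) = exponent u"

fun stem :: "normal_word \<Rightarrow> normal_word" where
  "stem (NA k) = 0"
| "stem (NX u) = NX (stem u)"
| "stem (NAX u) = NAX (stem u)"

lemma stem_add_exponent: "stem u + NA (exponent u) = u"
  by (induction u) simp_all

section \<open>Level and weight\<close>

fun syllables :: "normal_word \<Rightarrow> nat" where
  "syllables (NA k) = 0"
| "syllables (NX u) = Suc (syllables u)"
| "syllables (NAX u) = Suc (syllables u)"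

text \<open>
  After the leading \<open>b\<close>s of a word are stripped, what remains starts with \<open>x\<close> or is a power of \<open>a\<close>. In the
  first case the level counts its letters \<open>x\<close> and \<open>b\<close>; in the second it is minus the exponent, so
  that the level goes on dropping when multiplication by \<open>a\<close> has nothing left to delete.
\<close>

fun level :: "normal_word \<Rightarrow> int" where
  "level (NA k) = - int k"
| "level (NX u) = int (Suc (syllables u))"
| "level (NAX u) = level u"

lemma level_le_syllables: "level u \<le> int (syllables u)"
  by (induction u) auto

lemma level_left_a: "level (left_a u) \<le> level u - 1"
  by (induction u rule: left_a.induct) (simp_all add: level_le_syllables)

text \<open>
  The number of leading \<open>b\<close>s; it breaks ties between words of the same level.
\<close>

fun lead :: "normal_word \<Rightarrow> nat" where
  "lead (NA k) = 0"
| "lead (NX u) = 0"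
| "lead (NAX u) = Suc (lead u)"

lemma level_NAX_pow [simp]: "level ((NAX ^^ i) u) = level u"
  by (induction i) simp_all

lemma lead_NAX_pow [simp]: "lead ((NAX ^^ i) u) = i + lead u"
  by (induction i) simp_all

text \<open>
  The induction measure: counting \<open>x\<close> twice makes the step \<open>xu \<rightarrow> axu = bu\<close> of left multiplication
  by \<open>a\<close> a strict decrease, just as deleting a leading \<open>b\<close> is.
\<close>

fun weight :: "normal_word \<Rightarrow> nat" where
  "weight (NA k) = 0"
| "weight (NX u) = weight u + 2"
| "weight (NAX u) = weight u + 1"

lemma weight_left_a: "weight (left_a u) \<le> weight u - 1"
  by (induction u rule: left_a.induct) simp_all

definition level_le :: "int \<Rightarrow> (normal_word \<Rightarrow>\<^sub>0 bit) \<Rightarrow> bool" where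
  "level_le c y \<longleftrightarrow> (\<forall>u\<in>keys y. level u \<le> c)"

text \<open>
  Meaningful for nonzero \<open>y\<close> only.
\<close>

definition top_level :: "(normal_word \<Rightarrow>\<^sub>0 bit) \<Rightarrow> int" where
  "top_level y = Max (level ` keys y)"

lemma level_le_top: "level_le (top_level y) y"
  by (simp add: level_le_def top_level_def)

lemma top_attained: "y \<noteq> 0 \<Longrightarrow> \<exists>u\<in>keys y. level u = top_level y"
  using Max_in[of "level ` keys y"] by (fastforce simp: top_level_def)

lemma level_le_mono: "level_le c y \<Longrightarrow> c \<le> d \<Longrightarrow> level_le d y"
  by (auto simp: level_le_def)

lemma not_level_le_top_minus_1: "y \<noteq> 0 \<Longrightarrow> \<not> level_le (top_level y - 1) y"
  using top_attained[of y] by (force simp: level_le_def)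

lemma level_le_0 [simp]: "level_le c 0"
  by (simp add: level_le_def)

lemma level_le_add: "level_le c y \<Longrightarrow> level_le c z \<Longrightarrow> level_le c (y + z)"
  using Poly_Mapping.keys_add[of y z] by (auto simp: level_le_def)

lemma level_le_a_mult: "level_le c y \<Longrightarrow> level_le (c - 1) (a * y)"
proof -
  assume "level_le c y"
  moreover have "\<exists>v\<in>keys y. u = left_a v" if "u \<in> keys (a * y)" for u
    using that keys_mult[of a y] by auto
  ultimately show ?thesis
    unfolding level_le_def using level_left_a by (smt (verit, best))
qed

lemma top_a_mult: "a * y \<noteq> 0 \<Longrightarrow> top_level (a * y) \<le> top_level y - 1"
  using level_le_a_mult[OF level_le_top[of y]] top_attained[of "a * y"]
  by (auto simp: level_le_def)

text \<open>
  A nonzero polynomial \<open>q\<close> in \<open>b\<close> can be cancelled without increasing levels. If \<open>b\<^sup>d\<close> is the highest power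
  in \<open>q\<close> and \<open>u\<close> has the most leading \<open>b\<close>s among the words of \<open>y\<close> of level above \<open>c\<close>, then \<open>b\<^sup>d u\<close> is a
  unique product: in another factorisation \<open>b\<^sup>i u'\<close> the word \<open>u'\<close> has the level of \<open>u\<close>, so \<open>i \<le> d\<close>
  and \<open>u'\<close> has at most as many leading \<open>b\<close>s as \<open>u\<close>, while the totals agree.
\<close>

lemma level_le_b_poly_cancel:
  assumes q: "q \<noteq> 0" "keys q \<subseteq> range (\<lambda>i. (NAX ^^ i) 0)"
    and le: "level_le c (q * y)"
  shows "level_le c y"
proof (rule ccontr)
  let ?K = "{u \<in> keys y. level u > c}" and ?I = "{i. (NAX ^^ i) 0 \<in> keys q}"
  assume "\<not> level_le c y"
  then have K: "finite ?K" "?K \<noteq> {}" by (auto simp: level_le_def not_le)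
  then obtain u where u: "u \<in> ?K" "\<And>v. v \<in> ?K \<Longrightarrow> lead v \<le> lead u"
    using Max_in[of "lead ` ?K"] Max_ge[of "lead ` ?K"] by fastforce
  have "inj (\<lambda>i. (NAX ^^ i) 0)"
    by (rule injI, drule arg_cong[of _ _ lead]) (simp add: zero_normal_word_def)
  then have I: "finite ?I"
    using finite_vimageI[OF finite_keys[of q], of "\<lambda>i. (NAX ^^ i) 0"]
    by (simp add: vimage_def)
  obtain m where "m \<in> keys q" using q(1) by (metis all_not_in_conv keys_eq_empty)
  then have "?I \<noteq> {}" using q(2) by auto
  with I have d: "Max ?I \<in> ?I" by (rule Max_in)
  define d where "d = Max ?I"
  have "(NAX ^^ d) 0 + u \<in> keys (q * y)"
  proof (rule unique_product_in_keys)
    fix m' u' assume m': "m' \<in> keys q" and u': "u' \<in> keys y"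
      and eq: "m' + u' = (NAX ^^ d) 0 + u"
    obtain i where i: "m' = (NAX ^^ i) 0" using m' q(2) by auto
    have "i \<le> d" unfolding d_def using m' i I by (intro Max_ge) auto
    have eq': "(NAX ^^ i) u' = (NAX ^^ d) u"
      using eq i by simp
    from arg_cong[OF eq', of level] have "level u' = level u" by simp
    then have "lead u' \<le> lead u" using u u' by auto
    moreover from arg_cong[OF eq', of lead] have "i + lead u' = d + lead u" by simp
    ultimately have "i = d" using \<open>i \<le> d\<close> by simp
    then show "m' = (NAX ^^ d) 0 \<and> u' = u" using eq' i by simp
  qed (use u d in \<open>auto simp: d_def\<close>)
  then show False using le u(1) by (auto simp: level_le_def)
qed

text \<open>
  Division with remainder by \<open>b + 1\<close>. Since \<open>bu = (b + 1)u + u\<close>, leading \<open>b\<close>s can be removed one at a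
  time; the quotient collects the shorter words met on the way, hence the strict bound on its weight.
\<close>

lemma divide_by_b_plus_1:
  assumes "\<forall>u\<in>keys S. weight u \<le> N"
  shows "\<exists>S1 S0. S = (b + 1) * S1 + S0 \<and> (\<forall>u\<in>keys S1. weight u < N) \<and> (\<forall>u\<in>keys S0. lead u = 0)"
    (is "?P S")
proof (induction S rule: bit_poly_induct)
  case zero
  then show ?case by (intro exI[of _ 0]) simp
next
  case (add g h)
  then obtain g1 g0 h1 h0 where "g = (b + 1) * g1 + g0" "h = (b + 1) * h1 + h0"
    "\<forall>u\<in>keys g1. weight u < N" "\<forall>u\<in>keys g0. lead u = 0"
    "\<forall>u\<in>keys h1. weight u < N" "\<forall>u\<in>keys h0. lead u = 0" by auto
  then show ?case
    using Poly_Mapping.keys_add[of g1 h1] Poly_Mapping.keys_add[of g0 h0]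
    by (intro exI[of _ "g1 + h1"] exI[of _ "g0 + h0"]) (auto simp: distrib_left ac_simps)
next
  case (mon u)
  have "?P (mon u)" if "weight u \<le> N" for u
    using that
  proof (induction u)
    case (NAX u)
    then obtain S1 S0 where S: "mon u = (b + 1) * S1 + S0"
      "\<forall>u\<in>keys S1. weight u < N" "\<forall>u\<in>keys S0. lead u = 0" by auto
    have "mon (NAX u) = (b + 1) * mon u + mon u"
      by (simp add: distrib_right add.assoc b_mult_mon)
    also have "\<dots> = (b + 1) * mon u + ((b + 1) * S1 + S0)"
      by (simp only: S(1))
    also have "\<dots> = (b + 1) * (mon u + S1) + S0"
      by (simp only: distrib_left add.assoc)
    finally have "mon (NAX u) = (b + 1) * (mon u + S1) + S0" .
    moreover have "\<forall>v\<in>keys (mon u + S1). weight v < N"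
      using S(2) NAX.prems Poly_Mapping.keys_add[of "mon u" S1] by auto
    ultimately show ?case using S(3) by blast
  qed (rule exI[of _ 0], simp)+
  then show ?case using assms mon by simp
qed

text \<open>
  So no two words of a remainder modulo \<open>b + 1\<close> are merged by left multiplication by \<open>a\<close>.
\<close>

lemma left_a_inj_lead_0:
  "lead u = 0 \<Longrightarrow> lead v = 0 \<Longrightarrow> left_a u = left_a v \<Longrightarrow> u = v"
  by (cases u; cases v) auto

section \<open>The cancellation principle\<close>

text \<open>
  In this section \<open>w\<close> is a fixed right factor, and an exponent \<open>k\<close> is called dead if \<open>a\<^sup>k w = 0\<close>. Being below
  all the nonzero \<open>a\<^sup>k w\<close> is the weak form of vanishing that survives the induction.
\<close>

definition below_all :: "(normal_word \<Rightarrow>\<^sub>0 bit) \<Rightarrow> (normal_word \<Rightarrow>\<^sub>0 bit) \<Rightarrow> bool" where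
  "below_all w y \<longleftrightarrow> (\<forall>k. a ^ k * w \<noteq> 0 \<longrightarrow> level_le (top_level (a ^ k * w)) y)"

text \<open>
  The words that can occur in \<open>S\<close> when \<open>S w\<close> is merely below all nonzero \<open>a\<^sup>k w\<close>: besides those with dead
  exponent there are \<open>b\<^sup>i a\<^sup>k\<close> for the last exponent \<open>k\<close> that is not dead, because \<open>b\<^sup>i a\<^sup>k w\<close> lies on the
  level of \<open>a\<^sup>k w\<close>, which is the lowest one.
\<close>

definition nearly_dead :: "(normal_word \<Rightarrow>\<^sub>0 bit) \<Rightarrow> normal_word \<Rightarrow> bool" where
  "nearly_dead w u \<longleftrightarrow> a ^ exponent u * w = 0 \<or>
     a ^ Suc (exponent u) * w = 0 \<and> stem u \<in> range (\<lambda>i. (NAX ^^ i) 0)"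

lemma a_power_mult_eq_0_mono:
  assumes "a ^ k * w = 0" "k \<le> j"
  shows "a ^ j * w = 0"
proof -
  have "a ^ j * w = a ^ (j - k) * (a ^ k * w)"
    using assms(2) by (simp add: mult.assoc[symmetric] power_add[symmetric])
  then show ?thesis using assms(1) by simp
qed

lemma mon_mult_stem: "mon u * w = mon (stem u) * (a ^ exponent u * w)"
  by (simp only: a_power mult.assoc[symmetric] mult_single stem_add_exponent) simp

lemma a_power_Suc_mult: "a ^ Suc k * w = a * (a ^ k * w)"
  by (simp only: power_Suc mult.assoc)

lemma top_a_power_mult:
  "a ^ (i + Suc d) * w \<noteq> 0 \<Longrightarrow> top_level (a ^ (i + Suc d) * w) < top_level (a ^ i * w)"
proof (induction d)
  case 0
  then show ?case using top_a_mult[of "a ^ i * w"] by (simp add: a_power_Suc_mult del: power_Suc)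
next
  case (Suc d)
  have "a ^ (i + Suc d) * w \<noteq> 0"
    using Suc.prems a_power_mult_eq_0_mono[of "i + Suc d" w "i + Suc (Suc d)"] by fastforce
  moreover have "top_level (a ^ (i + Suc (Suc d)) * w) < top_level (a ^ (i + Suc d) * w)"
    using Suc.prems top_a_mult[of "a ^ (i + Suc d) * w"]
    by (simp add: a_power_Suc_mult del: power_Suc)
  ultimately show ?case using Suc.IH by simp
qed

lemma weight_a_mult:
  assumes "\<forall>u\<in>keys S. weight u \<le> N" "v \<in> keys (a * S)"
  shows "weight v \<le> N - 1"
proof -
  obtain u where "u \<in> keys S" "v = left_a u"
    using assms(2) keys_mult[of a S] by auto
  then show ?thesis using assms(1) weight_left_a[of u] by fastforce
qed

lemma below_all_a_mult:
  "below_all w y \<Longrightarrow> a ^ k * w \<noteq> 0 \<Longrightarrow> level_le (top_level (a ^ k * w) - 1) (a * y)"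
  unfolding below_all_def by (rule level_le_a_mult) blast

lemma below_all_add: "below_all w y \<Longrightarrow> below_all w z \<Longrightarrow> below_all w (y + z)"
  by (auto simp: below_all_def intro: level_le_add)

lemma below_all_last_power:
  assumes "a ^ Suc k * w = 0"
  shows "below_all w (a ^ k * w)"
  unfolding below_all_def
proof (intro allI impI)
  fix i assume i: "a ^ i * w \<noteq> 0"
  have "i \<le> k" using i a_power_mult_eq_0_mono[OF assms, of i] by (meson not_less_eq_eq)
  show "level_le (top_level (a ^ i * w)) (a ^ k * w)"
  proof (cases "i = k \<or> a ^ k * w = 0")
    case False
    then obtain d where "k = i + Suc d" using \<open>i \<le> k\<close> by (metis le_neq_implies_less less_imp_Suc_add add_Suc_right)
    then show ?thesis
      using False top_a_power_mult[of i d w] level_le_mono[OF level_le_top[of "a ^ k * w"]] by auto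
  qed (auto simp: level_le_top)
qed

lemma mult_eq_0_if_dead:
  assumes "\<And>u. u \<in> keys S \<Longrightarrow> a ^ exponent u * w = 0"
  shows "S * w = 0"
proof (induction S rule: bit_poly_induct)
  case (mon u)
  then show ?case using assms[of u] by (subst mon_mult_stem) simp
qed (simp_all add: distrib_right)

lemma level_left_a_pow: "level ((left_a ^^ j) v) \<le> level v - int j"
proof (induction j)
  case (Suc j)
  then show ?case using level_left_a[of "(left_a ^^ j) v"] by simp
qed simp

text \<open>
  The base of the induction: here \<open>S\<close> is a polynomial in \<open>a\<close>. If \<open>a\<^sup>k\<close> is its lowest power, then the top
  level of \<open>a\<^sup>k w\<close> exceeds that of all higher \<open>a\<^sup>j w\<close>, so it survives in \<open>S w\<close>. The assumed bound then
  forces \<open>k\<close> to be the last exponent that is not dead.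
\<close>

lemma nearly_dead_if_weight_0:
  assumes S: "\<forall>u\<in>keys S. weight u = 0" and below: "below_all w (S * w)" and u: "u \<in> keys S"
  shows "nearly_dead w u"
proof (cases "a ^ exponent u * w = 0")
  case False
  have NA: "v = NA (exponent v)" if "v \<in> keys S" for v
    using S that by (cases v) auto
  define k where "k = (LEAST k. NA k \<in> keys S)"
  have k: "NA k \<in> keys S" unfolding k_def using u NA[OF u] by (metis LeastI)
  have le: "k \<le> exponent v" if "v \<in> keys S" for v
    unfolding k_def using that NA[OF that] by (metis Least_le)
  have live: "a ^ k * w \<noteq> 0" using False le[OF u] a_power_mult_eq_0_mono by blast
  obtain q where q: "S = q * mon (NA k)" "keys q \<subseteq> (\<lambda>v. NA (exponent v - k)) ` keys S"
  proof (rule factor_mon_right)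
    fix v assume v: "v \<in> keys S"
    show "NA (exponent v - k) + NA k = v"
      by (subst (2) NA[OF v]) (use le[OF v] in simp)
  qed
  have Sw: "S * w = q * (a ^ k * w)" by (simp only: q(1) a_power mult.assoc)
  obtain m where m: "m \<in> keys q" "NA k = m + NA k"
    using k keys_mult[of q "mon (NA k)"] by (auto simp: q(1)[symmetric])
  then have "0 \<in> keys q" using q(2) by (auto simp: zero_normal_word_def)
  obtain v where v: "v \<in> keys (a ^ k * w)" "level v = top_level (a ^ k * w)"
    using top_attained[OF live] by blast
  \<comment> \<open>Multiplication by \<open>a\<^sup>j\<close> with \<open>j > 0\<close> lowers levels, so the top word \<open>v\<close> arises only from \<open>j = 0\<close>.\<close>
  have "0 + v \<in> keys (q * (a ^ k * w))"
  proof (rule unique_product_in_keys)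
    fix m' v' assume m': "m' \<in> keys q" and v': "v' \<in> keys (a ^ k * w)" and eq: "m' + v' = 0 + v"
    obtain j where j: "m' = NA j" using q(2) m' by auto
    then have "level v \<le> level v' - int j" using eq level_left_a_pow[of j v'] by simp
    moreover have "level v' \<le> level v"
      using v' v(2) level_le_top[of "a ^ k * w"] by (simp add: level_le_def)
    ultimately have "j = 0" by simp
    then show "m' = 0 \<and> v' = v" using j eq by (simp add: zero_normal_word_def)
  qed fact+
  then have "top_level (a ^ k * w) \<le> top_level (a ^ Suc k * w)" if "a ^ Suc k * w \<noteq> 0"
    using below that v(2) unfolding below_all_def level_le_def Sw by fastforce
  then have dead: "a ^ Suc k * w = 0"
    using top_a_power_mult[of k 0 w] by fastforce
  have "exponent u = k"
    using le[OF u] False a_power_mult_eq_0_mono[OF dead, of "exponent u"] by (metis le_antisym not_less_eq_eq)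
  moreover have "stem u = (NAX ^^ 0) 0" by (subst NA[OF u]) simp
  ultimately show ?thesis unfolding nearly_dead_def using dead by blast
qed (simp add: nearly_dead_def)

text \<open>
  A strict bound excludes the exceptional words: they all carry the same \<open>a\<^sup>k\<close>, so up to words that
  kill \<open>w\<close>, \<open>S\<close> is \<open>q a\<^sup>k\<close> with a polynomial \<open>q\<close> in \<open>b\<close>; cancelling \<open>q\<close> would put \<open>a\<^sup>k w\<close> strictly
  below itself.
\<close>

lemma dead_if_strictly_below:
  assumes S: "\<And>u. u \<in> keys S \<Longrightarrow> nearly_dead w u"
    and below: "\<And>k. a ^ k * w \<noteq> 0 \<Longrightarrow> level_le (top_level (a ^ k * w) - 1) (S * w)"
    and u: "u \<in> keys S"
  shows "a ^ exponent u * w = 0"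
proof (rule ccontr)
  assume live: "a ^ exponent u * w \<noteq> 0"
  obtain g h where gh: "S = g + h" "keys g = {v \<in> keys S. a ^ exponent v * w \<noteq> 0}"
    "keys h = {v \<in> keys S. \<not> a ^ exponent v * w \<noteq> 0}"
    by (rule split_keys)
  have last: "a ^ Suc (exponent v) * w = 0 \<and> stem v \<in> range (\<lambda>i. (NAX ^^ i) 0)" if "v \<in> keys g" for v
    using S[of v] that unfolding gh(2) nearly_dead_def by (simp del: power_Suc)
  have ug: "u \<in> keys g" using u live by (simp add: gh(2))
  have exp: "exponent v = exponent u" if "v \<in> keys g" for v
  proof -
    have "a ^ exponent v * w \<noteq> 0" using that by (simp add: gh(2))
    moreover have "m \<le> n" if "a ^ Suc n * w = 0" "a ^ m * w \<noteq> 0" for m n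
      using that a_power_mult_eq_0_mono[of "Suc n" w m] by (meson not_less_eq_eq)
    ultimately show ?thesis
      using live last[OF that] last[OF ug] by (intro antisym) auto
  qed
  obtain q where q: "g = q * mon (NA (exponent u))" "keys q \<subseteq> stem ` keys g"
  proof (rule factor_mon_right)
    show "stem v + NA (exponent u) = v" if "v \<in> keys g" for v
      using stem_add_exponent[of v] unfolding exp[OF that] .
  qed
  have "q \<noteq> 0" using q(1) ug by auto
  moreover have "keys q \<subseteq> range (\<lambda>i. (NAX ^^ i) 0)" using q(2) last by blast
  moreover have "h * w = 0" by (rule mult_eq_0_if_dead) (simp add: gh(3))
  then have "S * w = q * (a ^ exponent u * w)"
    by (simp only: gh(1) q(1) distrib_right a_power mult.assoc add_0_right)
  with below[OF live] have "level_le (top_level (a ^ exponent u * w) - 1) (q * (a ^ exponent u * w))"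
    by simp
  ultimately have "level_le (top_level (a ^ exponent u * w) - 1) (a ^ exponent u * w)"
    by (rule level_le_b_poly_cancel)
  then show False using not_level_le_top_minus_1[OF live] by blast
qed

lemma keys_b_plus_1: "keys (b + 1) \<subseteq> {NAX 0, 0}"
  using Poly_Mapping.keys_add[of b 1] by auto

lemma b_plus_1_ne_0: "b + 1 \<noteq> 0"
proof
  assume "b + 1 = 0"
  moreover have "Poly_Mapping.lookup (b + 1) (NAX 0) = 1"
    by (simp add: lookup_add lookup_one zero_normal_word_def)
  ultimately show False by simp
qed

lemma nearly_dead_NAX: "nearly_dead w u \<Longrightarrow> nearly_dead w (NAX u)"
proof -
  assume "nearly_dead w u"
  moreover have "NAX (stem u) \<in> range (\<lambda>i. (NAX ^^ i) 0)" if "stem u = (NAX ^^ i) 0" for i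
    using that rangeI[of "\<lambda>i. (NAX ^^ i) 0" "Suc i"] by simp
  ultimately show ?thesis
    by (auto simp: nearly_dead_def simp del: power_Suc)
qed

text \<open>
  The induction step. Left multiplication by \<open>a\<close> lowers both the bound on the weights in \<open>S\<close> and the levels in \<open>S w\<close>, so
  the induction hypothesis and the strict bound show that only dead exponents occur in \<open>a S\<close>. Write
  \<open>S = (b + 1) S\<^sub>1 + S\<^sub>0\<close> with remainder \<open>S\<^sub>0\<close> free of leading \<open>b\<close>s. Then \<open>a S = a S\<^sub>0\<close>, and the words of
  \<open>S\<^sub>0\<close> can be read off from it: each has dead exponent or is the last power of \<open>a\<close> that does not kill
  \<open>w\<close>. So \<open>S\<^sub>0 w\<close> obeys the bound, hence so does \<open>(b + 1) S\<^sub>1 w\<close>, hence \<open>S\<^sub>1 w\<close>, and the induction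
  hypothesis applies to the lighter \<open>S\<^sub>1\<close>.
\<close>

lemma nearly_dead_if_below_all:
  assumes "\<forall>u\<in>keys S. weight u \<le> N" and "below_all w (S * w)"
  shows "\<forall>u\<in>keys S. nearly_dead w u"
  using assms
proof (induction N arbitrary: S)
  case 0
  then show ?case using nearly_dead_if_weight_0 by auto
next
  case (Suc N)
  have strict: "level_le (top_level (a ^ k * w) - 1) (a * S * w)" if "a ^ k * w \<noteq> 0" for k
    using below_all_a_mult[OF Suc.prems(2) that] by (simp only: mult.assoc)
  have "\<forall>u\<in>keys (a * S). nearly_dead w u"
  proof (rule Suc.IH)
    show "\<forall>u\<in>keys (a * S). weight u \<le> N" using weight_a_mult[OF Suc.prems(1)] by simp
    show "below_all w (a * S * w)"
      unfolding below_all_def using level_le_mono[OF strict] by simp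
  qed
  then have dead: "a ^ exponent v * w = 0" if "v \<in> keys (a * S)" for v
    using dead_if_strictly_below[of "a * S" w v] strict that by blast
  obtain S1 S0 where div: "S = (b + 1) * S1 + S0" "\<forall>u\<in>keys S1. weight u < Suc N"
    "\<forall>u\<in>keys S0. lead u = 0"
    using divide_by_b_plus_1[OF Suc.prems(1)] by blast
  have "a * S = a * (b + 1) * S1 + a * S0"
    by (simp only: div(1) distrib_left[of a "(b + 1) * S1"] mult.assoc)
  then have aS: "a * S = a * S0" by (simp only: a_mult_b_plus_1 mult_zero_left add_0)
  have S0: "a ^ exponent u * w = 0 \<or> (\<exists>k. u = NA k \<and> a ^ Suc k * w = 0)" if u: "u \<in> keys S0" for u
  proof -
    \<comment> \<open>No cancellation: left multiplication by \<open>a\<close> is injective on words without leading \<open>b\<close>s.\<close>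
    have "NA (Suc 0) + u \<in> keys (a * S0)"
      using div(3) u by (intro unique_product_in_keys) (auto intro: left_a_inj_lead_0)
    then have "a ^ exponent (left_a u) * w = 0" using dead[of "left_a u"] aS by simp
    then show ?thesis using div(3) u by (cases u) auto
  qed
  have terms: "below_all w (mon u * w)" if "u \<in> keys S0" for u
    using S0[OF that] mon_mult_stem[of u w] below_all_last_power[of _ w]
    by (auto simp: a_power below_all_def)
  have "below_all w (S0 * w)"
    by (induction S0 rule: bit_poly_induct)
       (simp_all add: terms distrib_right below_all_add below_all_def[of w 0])
  with Suc.prems(2) have "below_all w (S * w + S0 * w)" by (rule below_all_add)
  moreover have "S * w + S0 * w = (b + 1) * (S1 * w)"
    by (simp only: div(1) distrib_right[of _ _ w] mult.assoc add.assoc add_self_bit_poly add_0_right)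
  moreover have "keys (b + 1) \<subseteq> range (\<lambda>i. (NAX ^^ i) 0)"
    using keys_b_plus_1 rangeI[of "\<lambda>i. (NAX ^^ i) 0" 0] rangeI[of "\<lambda>i. (NAX ^^ i) 0" 1] by auto
  ultimately have "below_all w (S1 * w)"
    unfolding below_all_def using level_le_b_poly_cancel[OF b_plus_1_ne_0] by simp
  then have S1: "\<forall>u\<in>keys S1. nearly_dead w u"
    using Suc.IH[of S1] div(2) by (simp add: less_Suc_eq_le)
  show ?case
  proof
    fix u assume "u \<in> keys S"
    then consider "u \<in> keys ((b + 1) * S1)" | "u \<in> keys S0"
      using Poly_Mapping.keys_add[of "(b + 1) * S1" S0] div(1) by auto
    then show "nearly_dead w u"
    proof cases
      case 1
      then obtain m v where "m \<in> keys (b + 1)" "v \<in> keys S1" "u = m + v"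
        using keys_mult[of "b + 1" S1] by auto
      then show ?thesis using keys_b_plus_1 S1 nearly_dead_NAX[of w v] by auto
    next
      case 2
      then show ?thesis
        using S0[OF 2] rangeI[of "\<lambda>i. (NAX ^^ i) 0" 0] by (auto simp: nearly_dead_def)
    qed
  qed
qed

theorem dead_if_product_eq_0:
  assumes "S * w = 0" "u \<in> keys S"
  shows "a ^ exponent u * w = 0"
proof (rule dead_if_strictly_below)
  have "\<forall>u\<in>keys S. weight u \<le> Max (weight ` keys S)" by simp
  moreover have "below_all w (S * w)" using assms(1) by (simp add: below_all_def)
  ultimately show "nearly_dead w v" if "v \<in> keys S" for v
    using nearly_dead_if_below_all that by blast
qed (use assms in simp_all)

text \<open>
  For \<open>w \<noteq> 0\<close> the exponent \<open>0\<close> is not dead, so every word of \<open>S\<close> ends in \<open>a\<close>.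
\<close>

lemma left_zero_divisor_iff_multiple_of_a:
  "(\<exists>w. w \<noteq> 0 \<and> S * w = 0) \<longleftrightarrow> (\<exists>r. S = r * a)"
proof
  assume "\<exists>w. w \<noteq> 0 \<and> S * w = 0"
  then obtain w where w: "w \<noteq> 0" "S * w = 0" by blast
  define drop_a where "drop_a u = stem u + NA (exponent u - 1)" for u
  obtain q where "S = q * mon (NA 1)" "keys q \<subseteq> drop_a ` keys S"
  proof (rule factor_mon_right)
    fix u assume "u \<in> keys S"
    then have "a ^ exponent u * w = 0" by (rule dead_if_product_eq_0[OF w(2)])
    then have "exponent u \<noteq> 0" using w(1) by (cases "exponent u") auto
    then have "NA (exponent u - 1) + NA 1 = NA (exponent u)" by simp
    then show "drop_a u + NA 1 = u"
      unfolding drop_a_def add.assoc using stem_add_exponent[of u] by (simp only:)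
  qed
  then show "\<exists>r. S = r * a" by auto
next
  assume "\<exists>r. S = r * a"
  then have "S * (b + 1) = 0" by (auto simp: mult.assoc a_mult_b_plus_1)
  then show "\<exists>w. w \<noteq> 0 \<and> S * w = 0" using b_plus_1_ne_0 by blast
qed

lemma right_zero_divisor_iff_a_power_torsion:
  "(\<exists>S. S \<noteq> 0 \<and> S * w = 0) \<longleftrightarrow> (\<exists>n\<ge>1. a ^ n * w = 0)"
proof
  assume "\<exists>S. S \<noteq> 0 \<and> S * w = 0"
  then obtain S u where "S * w = 0" "u \<in> keys S" by (metis all_not_in_conv keys_eq_empty)
  then have "a ^ exponent u * w = 0" by (rule dead_if_product_eq_0)
  then have "a ^ Suc (exponent u) * w = 0" by (rule a_power_mult_eq_0_mono) simp
  then show "\<exists>n\<ge>1. a ^ n * w = 0" by (intro exI[of _ "Suc (exponent u)"]) simp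
next
  assume "\<exists>n\<ge>1. a ^ n * w = 0"
  then show "\<exists>S. S \<noteq> 0 \<and> S * w = 0" using a_power_ne_0 by blast
qed

section \<open>Normal words of the free monoid\<close>

fun gen_nf :: "gen \<Rightarrow> normal_word" where
  "gen_nf Gen_a = NA 1"
| "gen_nf Gen_x = NX 0"

fun nf_list :: "gen list \<Rightarrow> normal_word" where
  "nf_list [] = 0"
| "nf_list (g # l) = gen_nf g + nf_list l"

definition nf :: "gen word \<Rightarrow> normal_word" where
  "nf u = nf_list (letters u)"

lemma nf_add: "nf (u + v) = nf u + nf v"
proof -
  have "nf_list (l @ m) = nf_list l + nf_list m" for l m
    by (induction l) (simp_all add: add.assoc)
  then show ?thesis by (simp add: nf_def plus_word_def)
qed

fun word_list :: "normal_word \<Rightarrow> gen list" where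
  "word_list (NA k) = replicate k Gen_a"
| "word_list (NX u) = Gen_x # word_list u"
| "word_list (NAX u) = Gen_a # Gen_x # word_list u"

definition word_of :: "normal_word \<Rightarrow> gen word" where
  "word_of u = Word (word_list u)"

lemma nf_word_of [simp]: "nf (word_of u) = u"
proof -
  have "nf_list (replicate k Gen_a) = NA k" for k
    by (induction k) (simp_all add: zero_normal_word_def)
  then have "nf_list (word_list u) = u"
    by (induction u) (simp_all add: zero_normal_word_def)
  then show ?thesis by (simp add: nf_def word_of_def)
qed

text \<open>
  The linear extension of a map between bases.
\<close>

definition push :: "('m \<Rightarrow> 'n) \<Rightarrow> ('m \<Rightarrow>\<^sub>0 bit) \<Rightarrow> ('n \<Rightarrow>\<^sub>0 bit)" where
  "push h f = (\<Sum>u\<in>keys f. mon (h u))"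

lemma push_0 [simp]: "push h 0 = 0"
  by (simp add: push_def)

lemma push_mon [simp]: "push h (mon u) = mon (h u)"
  by (simp add: push_def)

lemma push_add: "push h (f + g) = push h f + push h g"
proof -
  have *: "push h f = (\<Sum>u\<in>K. if Poly_Mapping.lookup f u = 1 then mon (h u) else 0)"
    if "finite K" "keys f \<subseteq> K" for f K
    unfolding push_def using that
    by (intro sum.mono_neutral_cong_left) (auto simp: in_keys_iff)
  let ?K = "keys f \<union> keys g"
  have "push h (f + g) = (\<Sum>u\<in>?K. (if Poly_Mapping.lookup f u = 1 then mon (h u) else 0)
      + (if Poly_Mapping.lookup g u = 1 then mon (h u) else 0))"
    unfolding *[of ?K "f + g", OF finite_UnI[OF finite_keys finite_keys] Poly_Mapping.keys_add]
    by (rule sum.cong) (auto simp: lookup_add)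
  also have "\<dots> = push h f + push h g"
    by (simp add: sum.distrib *[of ?K f] *[of ?K g])
  finally show ?thesis .
qed

lemma push_mult:
  assumes "\<And>u v. h (u + v) = h u + h v"
  shows "push h (f * g) = push h f * push h g"
proof (induction f rule: bit_poly_induct)
  case (mon u)
  show ?case
  proof (induction g rule: bit_poly_induct)
    case (mon v)
    show ?case by (simp add: mult_single assms)
  qed (simp_all add: distrib_left push_add)
qed (simp_all add: distrib_right push_add)

lemma push_push_inverse:
  assumes "\<And>u. h (k u) = u"
  shows "push h (push k f) = f"
  by (induction f rule: bit_poly_induct) (simp_all add: push_add assms)

abbreviation normalize :: "free_alg \<Rightarrow> (normal_word \<Rightarrow>\<^sub>0 bit)" where
  "normalize \<equiv> push nf"

lemma normalize_mult: "normalize (f * g) = normalize f * normalize g"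
  by (rule push_mult) (rule nf_add)

lemma normalize_surj: "normalize (push word_of v) = v"
  by (rule push_push_inverse) simp

lemma normalize_1 [simp]: "normalize 1 = 1"
proof -
  have "push nf (mon 0) = mon 0" by (simp add: nf_def zero_word_def)
  then show ?thesis by simp
qed

lemma normalize_a [simp]: "normalize (free_gen Gen_a) = a"
  by (simp add: free_gen_def nf_def zero_normal_word_def)

lemma normalize_x [simp]: "normalize (free_gen Gen_x) = mon (NX 0)"
  by (simp add: free_gen_def nf_def zero_normal_word_def)

lemma normalize_a_power: "normalize (free_gen Gen_a ^ n) = a ^ n"
  by (induction n) (simp_all add: normalize_mult)

section \<open>The presented ring as the algebra of normal words\<close>

lemma free_ring_simps [simp]:
  "carrier free_ring = UNIV" "f \<otimes>\<^bsub>free_ring\<^esub> g = f * g" "f \<oplus>\<^bsub>free_ring\<^esub> g = f + g"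
  "\<zero>\<^bsub>free_ring\<^esub> = 0" "\<one>\<^bsub>free_ring\<^esub> = 1"
  by (simp_all add: free_ring_def ring_of_type_algebra_def)

lemma rel_ideal_closed:
  "0 \<in> rel_ideal" "f \<in> rel_ideal \<Longrightarrow> g \<in> rel_ideal \<Longrightarrow> f + g \<in> rel_ideal"
  "f \<in> rel_ideal \<Longrightarrow> g * f \<in> rel_ideal" "f \<in> rel_ideal \<Longrightarrow> f * g \<in> rel_ideal"
proof -
  interpret I: ideal rel_ideal free_ring by (rule ideal_rel_ideal)
  show "0 \<in> rel_ideal" "f \<in> rel_ideal \<Longrightarrow> g \<in> rel_ideal \<Longrightarrow> f + g \<in> rel_ideal"
    "f \<in> rel_ideal \<Longrightarrow> g * f \<in> rel_ideal" "f \<in> rel_ideal \<Longrightarrow> f * g \<in> rel_ideal"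
    using additive_subgroup.zero_closed[OF I.additive_subgroup_axioms]
      additive_subgroup.a_closed[OF I.additive_subgroup_axioms, of f g]
      I.I_l_closed[of f g] I.I_r_closed[of f g]
    by simp_all
qed

lemma normalize_eq_0_if_rel_ideal:
  assumes "f \<in> rel_ideal"
  shows "normalize f = 0"
proof -
  interpret F: ring free_ring by (rule ring_free_ring)
  have K: "ideal {f. normalize f = 0} free_ring"
  proof (rule idealI)
    show "subgroup {f. normalize f = 0} (add_monoid free_ring)"
    proof (rule F.add.subgroupI)
      fix f assume "f \<in> {f. normalize f = 0}"
      moreover have "\<ominus>\<^bsub>free_ring\<^esub> f = f" by (rule F.minus_equality) simp_all
      ultimately show "\<ominus>\<^bsub>free_ring\<^esub> f \<in> {f. normalize f = 0}"
        by simp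
    qed (auto intro: exI[of _ 0] simp: push_add)
  qed (simp_all add: F.ring_axioms normalize_mult)
  have "normalize (free_gen Gen_a - free_gen Gen_a ^ 2 * free_gen Gen_x) = 0"
    by (simp add: push_add normalize_mult power2_eq_square mult_single zero_normal_word_def)
  then have "rel_ideal \<subseteq> {f. normalize f = 0}"
    unfolding rel_ideal_def by (intro F.genideal_minimal K) simp
  then show ?thesis using assms by blast
qed

lemma relation_in_rel_ideal:
  "free_gen Gen_a + free_gen Gen_a * free_gen Gen_a * free_gen Gen_x \<in> rel_ideal"
proof -
  have "free_gen Gen_a - free_gen Gen_a ^ 2 * free_gen Gen_x \<in> rel_ideal"
    unfolding rel_ideal_def using ring.genideal_self'[OF ring_free_ring] by simp
  then show ?thesis by (simp add: power2_eq_square)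
qed

lemma mon_Word_Cons: "mon (Word (g # l)) = free_gen g * mon (Word l)"
  by (simp add: free_gen_def mult_single plus_word_def)

text \<open>
  The only case that uses the relation is \<open>u = axv\<close>, where \<open>a(axv) \<equiv> av\<close> and the argument repeats with
  the shorter word \<open>v\<close>.
\<close>

lemma a_word_of: "free_gen Gen_a * mon (word_of u) + mon (word_of (left_a u)) \<in> rel_ideal"
proof (induction u)
  case (NAX u)
  let ?A = "free_gen Gen_a" and ?X = "free_gen Gen_x" and ?u = "mon (word_of u)"
  have "(?A + ?A * ?A * ?X) * ?u + (?A * ?u + mon (word_of (left_a u))) \<in> rel_ideal"
    by (intro rel_ideal_closed relation_in_rel_ideal NAX)
  moreover have "(?A + ?A * ?A * ?X) * ?u + (?A * ?u + mon (word_of (left_a u)))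
     = (?A * ?u + ?A * ?u) + (?A * (?A * (?X * ?u)) + mon (word_of (left_a u)))"
    by (simp only: distrib_right mult.assoc ac_simps)
  moreover have "?A * (?X * ?u) = mon (word_of (NAX u))"
    by (simp add: word_of_def mon_Word_Cons)
  ultimately show ?case by simp
qed (simp_all add: word_of_def mon_Word_Cons rel_ideal_closed)

lemma word_of_nf_list: "mon (Word l) + mon (word_of (nf_list l)) \<in> rel_ideal"
proof (induction l)
  case Nil
  then show ?case by (simp add: word_of_def zero_normal_word_def rel_ideal_closed)
next
  case (Cons g l)
  let ?w = "mon (word_of (nf_list l))"
  have "free_gen g * ?w + mon (word_of (gen_nf g + nf_list l)) \<in> rel_ideal"
  proof (cases g)
    case Gen_a
    then show ?thesis using a_word_of[of "nf_list l"] by simp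
  next
    case Gen_x
    then show ?thesis
      by (simp add: zero_normal_word_def word_of_def mon_Word_Cons rel_ideal_closed)
  qed
  then have "free_gen g * (mon (Word l) + ?w) + (free_gen g * ?w + mon (word_of (gen_nf g + nf_list l)))
      \<in> rel_ideal"
    by (rule rel_ideal_closed(2)[OF rel_ideal_closed(3)[OF Cons]])
  moreover have "free_gen g * (mon (Word l) + ?w) + (free_gen g * ?w + mon (word_of (gen_nf g + nf_list l)))
     = (free_gen g * ?w + free_gen g * ?w) + (free_gen g * mon (Word l) + mon (word_of (gen_nf g + nf_list l)))"
    by (simp only: distrib_left ac_simps)
  ultimately show ?case by (simp add: mon_Word_Cons)
qed

lemma normalize_section: "f + push word_of (normalize f) \<in> rel_ideal"
proof (induction f rule: bit_poly_induct)
  case zero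
  then show ?case by (simp add: rel_ideal_closed)
next
  case (mon u)
  then show ?case using word_of_nf_list[of "letters u"] by (simp add: nf_def)
next
  case (add g h)
  then have "(g + push word_of (normalize g)) + (h + push word_of (normalize h)) \<in> rel_ideal"
    by (rule rel_ideal_closed)
  then show ?case by (simp add: push_add ac_simps)
qed

text \<open>
  One inclusion holds because
  \<open>aax\<close> and \<open>a\<close> have the same normal form; the other because each word is congruent to its normal form.
\<close>

lemma in_rel_ideal_iff: "f \<in> rel_ideal \<longleftrightarrow> normalize f = 0"
  using normalize_section[of f] normalize_eq_0_if_rel_ideal[of f] by auto

definition cls :: "free_alg \<Rightarrow> free_alg set" where
  "cls f = rel_ideal +>\<^bsub>free_ring\<^esub> f"

text \<open>
  Together with surjectivity of normalization, this identifies the quotient with the algebra of normal words.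
\<close>

lemma cls_eq_iff: "cls f = cls g \<longleftrightarrow> normalize f = normalize g"
proof -
  have "cls f = {h + f | h. normalize h = 0}" for f
    by (auto simp: cls_def a_r_coset_def r_coset_def in_rel_ideal_iff)
  then have eq: "cls f = {k. normalize k = normalize f}" for f
  proof -
    have "k \<in> {h + f | h. normalize h = 0}" if "normalize k = normalize f" for k
      using that by (intro CollectI exI[of _ "k + f"]) (simp add: push_add add.assoc)
    then show ?thesis using \<open>\<And>f. cls f = _\<close> by (auto simp: push_add)
  qed
  show ?thesis unfolding eq by auto
qed

lemma carrier_R_alg: "carrier R_alg = range cls"
  by (auto simp: R_alg_def FactRing_def A_RCOSETS_def' cls_def)

lemma cls_mult: "cls f \<otimes>\<^bsub>R_alg\<^esub> cls g = cls (f * g)"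
  by (simp add: R_alg_def FactRing_def cls_def ideal.rcoset_mult_add[OF ideal_rel_ideal])

lemma zero_R_alg: "\<zero>\<^bsub>R_alg\<^esub> = cls 0"
proof -
  have "cls 0 = rel_ideal" by (auto simp: cls_def a_r_coset_def r_coset_def)
  then show ?thesis by (simp add: R_alg_def FactRing_def)
qed

lemma one_R_alg: "\<one>\<^bsub>R_alg\<^esub> = cls 1"
  by (simp add: R_alg_def FactRing_def cls_def)

lemma elem_a_power: "elem_a [^]\<^bsub>R_alg\<^esub> (n::nat) = cls (free_gen Gen_a ^ n)"
proof -
  interpret Q: ring R_alg by (rule ring_R_alg)
  show ?thesis
    by (induction n) (simp_all add: one_R_alg cls_mult elem_a_def cls_def[symmetric] power_commutes)
qed

lemma left_zero_divisors_iff: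
  "cls f \<in> left_zero_divisors R_alg \<longleftrightarrow> (\<exists>w. w \<noteq> 0 \<and> normalize f * w = 0)"
proof -
  have ann: "right_ann R_alg (cls f) = {cls g | g. normalize f * normalize g = 0}"
  proof -
    have "cls g \<in> right_ann R_alg (cls f) \<longleftrightarrow> normalize f * normalize g = 0" for g
      by (simp add: right_ann_def carrier_R_alg zero_R_alg cls_mult cls_eq_iff normalize_mult)
    moreover have "right_ann R_alg (cls f) \<subseteq> range cls"
      by (auto simp: right_ann_def carrier_R_alg)
    ultimately show ?thesis by blast
  qed
  then have "\<zero>\<^bsub>R_alg\<^esub> \<in> right_ann R_alg (cls f)"
    by (auto simp: zero_R_alg intro!: exI[of _ 0])
  then have "cls f \<in> left_zero_divisors R_alg \<longleftrightarrow>
      (\<exists>t \<in> right_ann R_alg (cls f). t \<noteq> \<zero>\<^bsub>R_alg\<^esub>)"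
    by (auto simp: left_zero_divisors_def carrier_R_alg)
  also have "\<dots> \<longleftrightarrow> (\<exists>g. cls g \<noteq> cls 0 \<and> normalize f * normalize g = 0)"
    unfolding ann zero_R_alg by blast
  also have "\<dots> \<longleftrightarrow> (\<exists>g. normalize g \<noteq> 0 \<and> normalize f * normalize g = 0)"
    by (simp add: cls_eq_iff)
  also have "\<dots> \<longleftrightarrow> (\<exists>w. w \<noteq> 0 \<and> normalize f * w = 0)" by (metis normalize_surj)
  finally show ?thesis .
qed

lemma right_zero_divisors_iff:
  "cls f \<in> right_zero_divisors R_alg \<longleftrightarrow> (\<exists>w. w \<noteq> 0 \<and> w * normalize f = 0)"
proof -
  have ann: "left_ann R_alg (cls f) = {cls g | g. normalize g * normalize f = 0}"
  proof -
    have "cls g \<in> left_ann R_alg (cls f) \<longleftrightarrow> normalize g * normalize f = 0" for g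
      by (simp add: left_ann_def carrier_R_alg zero_R_alg cls_mult cls_eq_iff normalize_mult)
    moreover have "left_ann R_alg (cls f) \<subseteq> range cls"
      by (auto simp: left_ann_def carrier_R_alg)
    ultimately show ?thesis by blast
  qed
  then have "\<zero>\<^bsub>R_alg\<^esub> \<in> left_ann R_alg (cls f)"
    by (auto simp: zero_R_alg intro!: exI[of _ 0])
  then have "cls f \<in> right_zero_divisors R_alg \<longleftrightarrow>
      (\<exists>t \<in> left_ann R_alg (cls f). t \<noteq> \<zero>\<^bsub>R_alg\<^esub>)"
    by (auto simp: right_zero_divisors_def carrier_R_alg)
  also have "\<dots> \<longleftrightarrow> (\<exists>g. cls g \<noteq> cls 0 \<and> normalize g * normalize f = 0)"
    unfolding ann zero_R_alg by blast
  also have "\<dots> \<longleftrightarrow> (\<exists>g. normalize g \<noteq> 0 \<and> normalize g * normalize f = 0)"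
    by (simp add: cls_eq_iff)
  also have "\<dots> \<longleftrightarrow> (\<exists>w. w \<noteq> 0 \<and> w * normalize f = 0)" by (metis normalize_surj)
  finally show ?thesis .
qed

theorem corollary3p7:
  shows "left_zero_divisors R_alg = {r \<otimes>\<^bsub>R_alg\<^esub> elem_a | r. r \<in> carrier R_alg}
    \<and> right_zero_divisors R_alg = (\<Union>n\<in>{1::nat..}. right_ann R_alg (elem_a [^]\<^bsub>R_alg\<^esub> n))"
proof -
  have a: "elem_a = cls (free_gen Gen_a)" by (simp add: elem_a_def cls_def)
  have left: "s \<in> left_zero_divisors R_alg \<longleftrightarrow> s \<in> {r \<otimes>\<^bsub>R_alg\<^esub> elem_a | r. r \<in> carrier R_alg}" for s
  proof (cases "s \<in> carrier R_alg")
    case True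
    then obtain f where s: "s = cls f" by (auto simp: carrier_R_alg)
    have "s \<in> {r \<otimes>\<^bsub>R_alg\<^esub> elem_a | r. r \<in> carrier R_alg} \<longleftrightarrow>
        (\<exists>g. s = cls g \<otimes>\<^bsub>R_alg\<^esub> elem_a)"
      by (auto simp: carrier_R_alg)
    also have "\<dots> \<longleftrightarrow> (\<exists>g. normalize f = normalize g * a)"
      by (simp add: s a cls_mult cls_eq_iff normalize_mult)
    also have "\<dots> \<longleftrightarrow> (\<exists>r. normalize f = r * a)" by (metis normalize_surj)
    finally show ?thesis
      by (simp add: s left_zero_divisors_iff left_zero_divisor_iff_multiple_of_a)
  next
    case False
    then show ?thesis
      by (auto simp: left_zero_divisors_def carrier_R_alg a cls_mult)
  qed
  have right: "s \<in> right_zero_divisors R_alg \<longleftrightarrow>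
    s \<in> (\<Union>n\<in>{1::nat..}. right_ann R_alg (elem_a [^]\<^bsub>R_alg\<^esub> n))" for s
  proof (cases "s \<in> carrier R_alg")
    case True
    then obtain f where s: "s = cls f" by (auto simp: carrier_R_alg)
    have "s \<in> right_ann R_alg (elem_a [^]\<^bsub>R_alg\<^esub> n) \<longleftrightarrow> a ^ n * normalize f = 0" for n :: nat
      by (simp add: right_ann_def s carrier_R_alg elem_a_power cls_mult zero_R_alg cls_eq_iff
          normalize_mult normalize_a_power)
    then show ?thesis
      by (auto simp: s right_zero_divisors_iff right_zero_divisor_iff_a_power_torsion)
  next
    case False
    then show ?thesis by (auto simp: right_zero_divisors_def right_ann_def)
  qed
  show ?thesis using left right by (intro conjI Set.set_eqI)
qed

end
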